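(* For every non-negative integer $n$ and every integer $s$, \[ \sum_{k = 0}^{\lfloor n/2 \rfloor} \binom {n}{2k} 9^{k} F_{6k + s} = 2^{n-1} \begin{cases} F_{4n + s} + 5^{n/2} F_{2n+s}, & \text{$n$ even;}\\ F_{4n + s} - 5^{(n-1)/2}L_{2n+s}, & \text{$n$ odd,} \end{cases} \] \[ \sum_{k = 0}^{\lfloor n/2 \rfloor} \binom {n}{2k} 9^{k} L_{6k + s} = 2^{n-1} \begin{cases} L_{4n + s} + 5^{n/2}L_{2n+s}, & \text{$n$ even;}\\ L_{4n + s} - 5^{(n+1)/2}F_{2n+s}, & \text{$n$ odd.} \end{cases} \]
   Context: The Fibonacci numbers $F_j$ and Lucas numbers $L_j$ are defined for all integers $j$ by $F_0=0$, $F_1=1$, $L_0=2$, $L_1=1$, $F_j=F_{j-1}+F_{j-2}$, $L_j=L_{j-1}+L_{j-2}$, with $F_{-j}=(-1)^{j-1}F_j$ and $L_{-j}=(-1)^jL_j$. *)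

theory Defs
  imports Complex_Main "HOL-Number_Theory.Fib"
begin

fun lucas_nat :: "nat \<Rightarrow> nat" where
  "lucas_nat 0 = 2"
| "lucas_nat (Suc 0) = 1"
| "lucas_nat (Suc (Suc n)) = lucas_nat (Suc n) + lucas_nat n"

definition fib_int :: "int \<Rightarrow> int" where
  "fib_int j = (if 0 \<le> j then int (fib (nat j))
                else (-1) ^ (nat (- j) - 1) * int (fib (nat (- j))))"

definition lucas_int :: "int \<Rightarrow> int" where
  "lucas_int j = (if 0 \<le> j then int (lucas_nat (nat j))
                  else (-1) ^ nat (- j) * int (lucas_nat (nat (- j))))"

lemma fib_int_0: "fib_int 0 = 0" and fib_int_1: "fib_int 1 = 1"
  by (simp_all add: fib_int_def)

lemma lucas_int_0: "lucas_int 0 = 2" and lucas_int_1: "lucas_int 1 = 1"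
  by (simp_all add: lucas_int_def)

lemma int_cases_ge2:
  obtains m where "j = int (Suc (Suc m))" | "j = 1" | m where "j = - int m"
proof (cases "j \<le> 0")
  case True
  then have "j = - int (nat (- j))" by simp
  then show ?thesis by (rule that(3))
next
  case False
  show ?thesis
  proof (cases "j = 1")
    case True
    then show ?thesis by (rule that(2))
  next
    case neq: False
    have "j = int (Suc (Suc (nat (j - 2))))" using False neq by simp
    then show ?thesis by (rule that(1))
  qed
qed

lemma fib_int_rec: "fib_int j = fib_int (j - 1) + fib_int (j - 2)"
proof (cases j rule: int_cases_ge2)
  case (1 m)
  then show ?thesis by (simp add: fib_int_def nat_add_distrib)
next
  case 2
  then show ?thesis by (simp add: fib_int_def)
next
  case (3 m)
  have eq: "nat (int m + 1) = Suc m" "nat (int m + 2) = Suc (Suc m)"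
    by simp_all
  show ?thesis
    by (cases m) (simp_all add: 3 fib_int_def eq nat_add_distrib numeral_eq_Suc algebra_simps)
qed

lemma lucas_int_rec: "lucas_int j = lucas_int (j - 1) + lucas_int (j - 2)"
proof (cases j rule: int_cases_ge2)
  case (1 m)
  then show ?thesis by (simp add: lucas_int_def nat_add_distrib)
next
  case 2
  then show ?thesis by (simp add: lucas_int_def)
next
  case (3 m)
  have eq: "nat (int m + 1) = Suc m" "nat (int m + 2) = Suc (Suc m)"
    by simp_all
  show ?thesis
    by (cases m) (simp_all add: 3 lucas_int_def eq nat_add_distrib numeral_eq_Suc algebra_simps)
qed

end

theory Submission
  imports Defs
begin

text \<open>
  Let \<open>x\<close> be a root of \<open>x\<^sup>2 = x + 1\<close> and \<open>d = 2 * x - 1\<close>, so \<open>d\<^sup>2 = 5\<close>. Then \<open>1 + 3 * x\<^sup>3 = 2 * x\<^sup>4\<close> and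
  \<open>1 - 3 * x\<^sup>3 = - 2 * d * x\<^sup>2\<close>, so the even part of the binomial expansion of \<open>(1 + 3 * x\<^sup>3)\<^sup>n\<close>
  has a closed form in powers of \<open>x\<close>. The two roots have \<open>d = sqrt 5\<close> and \<open>d = - sqrt 5\<close>; this sign
  is what exchanges Fibonacci and Lucas numbers for odd \<open>n\<close> when the two identities are combined
  by Binet's formulas.
\<close>

text \<open>Adding the expansions of \<open>(1 + y) ^ n\<close> and \<open>(1 - y) ^ n\<close>
  cancels the odd powers of \<open>y\<close> and doubles the even ones. Keeping the factor 2 on the
  left avoids division, so any commutative ring will do.\<close>

lemma sum_even_binomial:
  fixes y :: "'a :: comm_ring_1"
  shows "2 * (\<Sum>k = 0..n div 2. of_nat (n choose (2 * k)) * (y\<^sup>2) ^ k) = (1 + y) ^ n + (1 - y) ^ n"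
proof -
  have "(1 + y) ^ n + (1 - y) ^ n
      = (\<Sum>k\<le>n. of_nat (n choose k) * (y ^ k + (- y) ^ k))"
    using binomial_ring[of y 1 n] binomial_ring[of "- y" 1 n]
    by (simp add: sum.distrib distrib_left add.commute)
  also have "\<dots> = (\<Sum>k\<in>(*) 2 ` {0..n div 2}. of_nat (n choose k) * (y ^ k + (- y) ^ k))"
  proof (rule sum.mono_neutral_right)
    show "\<forall>k\<in>{..n} - (*) 2 ` {0..n div 2}. of_nat (n choose k) * (y ^ k + (- y) ^ k) = 0"
    proof
      fix k assume k: "k \<in> {..n} - (*) 2 ` {0..n div 2}"
      have "odd k"
      proof
        assume "even k"
        then have "k = 2 * (k div 2)" "k div 2 \<in> {0..n div 2}"
          using k by (auto simp: div_le_mono)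
        with k show False by blast
      qed
      then show "of_nat (n choose k) * (y ^ k + (- y) ^ k) = 0" by simp
    qed
  qed auto
  also have "\<dots> = (\<Sum>k = 0..n div 2. of_nat (n choose (2 * k)) * (y ^ (2 * k) + (- y) ^ (2 * k)))"
    by (subst sum.reindex) (auto simp: inj_on_def)
  also have "\<dots> = 2 * (\<Sum>k = 0..n div 2. of_nat (n choose (2 * k)) * (y\<^sup>2) ^ k)"
    unfolding sum_distrib_left by (intro sum.cong refl) (simp only: power_mult power2_minus, simp flip: mult_2)
  finally show ?thesis ..
qed

text \<open>This is \<open>sum_even_binomial\<close> at \<open>y = 3 * x ^ 3\<close>, where
  \<open>y ^ 2 = 9 * x ^ 6\<close> supplies the weights, multiplied through by
  \<open>x powi s\<close>.\<close>

lemma golden_binomial_sum: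
  fixes x :: real
  assumes x: "x\<^sup>2 = x + 1"
  shows "(\<Sum>k = 0..n div 2. real (n choose (2 * k)) * 9 ^ k * x powi (6 * int k + s))
      = 2 powi (int n - 1) * (x powi (4 * int n + s) + (1 - 2 * x) ^ n * x powi (2 * int n + s))"
proof -
  have x0: "x \<noteq> 0" using x by auto
  have shift: "x powi (int m * int k + s) = (x ^ m) ^ k * x powi s" for m k
  proof -
    have "x powi (int m * int k) = (x ^ m) ^ k"
      by (simp only: power_int_of_nat power_mult flip: of_nat_mult)
    then show ?thesis using x0 by (simp add: power_int_add)
  qed
  \<comment> \<open>The hypothesis reduces powers to linear terms: \<open>x ^ 3 = 2 * x + 1\<close>
    and \<open>x ^ 4 = 3 * x + 2\<close>.\<close>
  have "1 + 3 * x ^ 3 = 2 * x ^ 4" "1 - 3 * x ^ 3 = 2 * ((1 - 2 * x) * x\<^sup>2)"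
    using x by algebra+
  then have "2 * (\<Sum>k = 0..n div 2. real (n choose (2 * k)) * ((3 * x ^ 3)\<^sup>2) ^ k)
      = 2 ^ n * ((x ^ 4) ^ n + (1 - 2 * x) ^ n * (x\<^sup>2) ^ n)"
    by (subst sum_even_binomial) (simp only: power_mult_distrib distrib_left)
  moreover have "((3 * x ^ 3)\<^sup>2) ^ k = 9 ^ k * (x ^ 6) ^ k" for k
    by (simp add: power_mult_distrib flip: power_mult)
  \<comment> \<open>The exponent \<open>int n - 1\<close> is an integer because \<open>n = 0\<close>
    gives the factor 1/2.\<close>
  moreover have "(2::real) ^ n = 2 * 2 powi (int n - 1)"
    by (simp add: power_int_diff)
  ultimately have "(\<Sum>k = 0..n div 2. real (n choose (2 * k)) * (9 ^ k * (x ^ 6) ^ k))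
      = 2 powi (int n - 1) * ((x ^ 4) ^ n + (1 - 2 * x) ^ n * (x\<^sup>2) ^ n)"
    by simp
  then have "(\<Sum>k = 0..n div 2. real (n choose (2 * k)) * (9 ^ k * (x ^ 6) ^ k)) * x powi s
      = 2 powi (int n - 1) * ((x ^ 4) ^ n + (1 - 2 * x) ^ n * (x\<^sup>2) ^ n) * x powi s"
    by simp
  then show ?thesis
    using shift[of 6] shift[of 4 n] shift[of 2 n]
    by (simp add: sum_distrib_left algebra_simps)
qed

text \<open>Two consecutive values determine the sequence in both directions, since the recurrence
  can also be solved for \<open>f (j - 2)\<close>. Hence the induction carries a pair of
  neighbouring values.\<close>

lemma fibonacci_recurrence_unique:
  fixes f g :: "int \<Rightarrow> 'a :: ab_group_add"
  assumes f: "\<And>j. f j = f (j - 1) + f (j - 2)" and g: "\<And>j. g j = g (j - 1) + g (j - 2)"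
    and "f 0 = g 0" "f 1 = g 1"
  shows "f j = g j"
proof -
  have "f j = g j \<and> f (j + 1) = g (j + 1)"
  proof (induction j rule: int_induct[where k = 0])
    case base
    show ?case using assms(3,4) by simp
  next
    case (step1 i)
    then show ?case using f[of "i + 2"] g[of "i + 2"] by (simp add: algebra_simps)
  next
    case (step2 i)
    then show ?case using f[of "i + 1"] g[of "i + 1"] by auto
  qed
  then show ?thesis ..
qed

definition golden :: real where "golden = (1 + sqrt 5) / 2"

definition golden_conj :: real where "golden_conj = (1 - sqrt 5) / 2"

lemma golden_square: "golden\<^sup>2 = golden + 1" "golden_conj\<^sup>2 = golden_conj + 1"
  by (simp_all add: golden_def golden_conj_def field_simps power2_eq_square)

text \<open>Multiply \<open>x\<^sup>2 = x + 1\<close> by \<open>x powi (j - 2)\<close>; this covers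
  negative \<open>j\<close> because \<open>x\<close> cannot be 0.\<close>

lemma powi_golden_rec:
  fixes x :: real
  assumes x: "x\<^sup>2 = x + 1"
  shows "x powi j = x powi (j - 1) + x powi (j - 2)"
proof -
  have x0: "x \<noteq> 0" using x by auto
  have "x powi (j - 2) * x\<^sup>2 = x powi (j - 2) * (x + 1)" using x by simp
  with x0 show ?thesis by (simp add: power_int_diff power2_eq_square field_simps)
qed

text \<open>Both sides satisfy the recurrence on all integers and agree at 0 and 1.\<close>

lemma fib_int_Binet: "real_of_int (fib_int j) = (golden powi j - golden_conj powi j) / sqrt 5"
proof (rule fibonacci_recurrence_unique)
  show "real_of_int (fib_int j) = real_of_int (fib_int (j - 1)) + real_of_int (fib_int (j - 2))" for j
    using fib_int_rec[of j] by simp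
  show "(golden powi j - golden_conj powi j) / sqrt 5
      = (golden powi (j - 1) - golden_conj powi (j - 1)) / sqrt 5
        + (golden powi (j - 2) - golden_conj powi (j - 2)) / sqrt 5" for j
    using golden_square[THEN powi_golden_rec, of j] by (simp add: diff_divide_distrib add_divide_distrib)
qed (simp_all add: fib_int_0 fib_int_1 golden_def golden_conj_def field_simps)

lemma lucas_int_Binet: "real_of_int (lucas_int j) = golden powi j + golden_conj powi j"
proof (rule fibonacci_recurrence_unique)
  show "real_of_int (lucas_int j)
      = real_of_int (lucas_int (j - 1)) + real_of_int (lucas_int (j - 2))" for j
    using lucas_int_rec[of j] by simp
  show "golden powi j + golden_conj powi j
      = golden powi (j - 1) + golden_conj powi (j - 1)
        + (golden powi (j - 2) + golden_conj powi (j - 2))" for j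
    using golden_square[THEN powi_golden_rec, of j] by simp
qed (simp_all add: lucas_int_0 lucas_int_1 golden_def golden_conj_def field_simps)

theorem theorem14:
  fixes n :: nat and s :: int
  shows "(\<Sum>k = 0..n div 2. real (n choose (2 * k)) * 9 ^ k * real_of_int (fib_int (6 * int k + s)))
      = 2 powi (int n - 1) *
        (if even n
         then real_of_int (fib_int (4 * int n + s)) + 5 ^ (n div 2) * real_of_int (fib_int (2 * int n + s))
         else real_of_int (fib_int (4 * int n + s)) - 5 ^ ((n - 1) div 2) * real_of_int (lucas_int (2 * int n + s)))
    \<and> (\<Sum>k = 0..n div 2. real (n choose (2 * k)) * 9 ^ k * real_of_int (lucas_int (6 * int k + s)))
      = 2 powi (int n - 1) *
        (if even n
         then real_of_int (lucas_int (4 * int n + s)) + 5 ^ (n div 2) * real_of_int (lucas_int (2 * int n + s))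
         else real_of_int (lucas_int (4 * int n + s)) - 5 ^ ((n + 1) div 2) * real_of_int (fib_int (2 * int n + s)))"
proof -
  let ?a = golden and ?b = golden_conj
  define S where "S x = (\<Sum>k = 0..n div 2. real (n choose (2 * k)) * 9 ^ k * x powi (6 * int k + s))"
    for x :: real
  have d: "1 - 2 * ?a = - sqrt 5" "1 - 2 * ?b = sqrt 5"
    by (simp_all add: golden_def golden_conj_def field_simps)
  note S_closed = golden_square[THEN golden_binomial_sum, of n s, folded S_def, unfolded d]
  have F: "(\<Sum>k = 0..n div 2. real (n choose (2 * k)) * 9 ^ k * real_of_int (fib_int (6 * int k + s)))
      = (S ?a - S ?b) / sqrt 5"
    by (simp add: S_def fib_int_Binet sum_subtractf sum_divide_distrib right_diff_distrib diff_divide_distrib)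
  have L: "(\<Sum>k = 0..n div 2. real (n choose (2 * k)) * 9 ^ k * real_of_int (lucas_int (6 * int k + s)))
      = S ?a + S ?b"
    by (simp add: S_def lucas_int_Binet sum.distrib distrib_left)
  show ?thesis
  proof (cases "even n")
    case True
    then obtain m where n: "n = 2 * m" by (elim evenE)
    \<comment> \<open>For even \<open>n\<close> the sign of \<open>sqrt 5\<close> disappears, so
      differences of powers stay differences and sums stay sums.\<close>
    have pow: "sqrt 5 ^ n = 5 ^ m" "(- sqrt 5) ^ n = 5 ^ m"
      by (simp_all add: n power_mult)
    have div: "n div 2 = m" by (simp add: n)
    have combine: "(p * (u + q * v) - p * (w + q * z)) / sqrt 5 = p * ((u - w) / sqrt 5 + q * ((v - z) / sqrt 5))"
      "p * (u + q * v) + p * (w + q * z) = p * (u + w + q * (v + z))" for p q u v w z :: real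
      by (simp_all add: field_simps)
    show ?thesis
      unfolding F L S_closed pow unfolding fib_int_Binet lucas_int_Binet if_P[OF True] div
      by (intro conjI combine)
  next
    case False
    then obtain m where n: "n = 2 * m + 1" by (elim oddE)
    have pow: "sqrt 5 ^ n = 5 ^ m * sqrt 5" "(- sqrt 5) ^ n = - (5 ^ m * sqrt 5)"
      by (simp_all add: n power_add power_mult)
    have div: "(n - 1) div 2 = m" "(n + 1) div 2 = Suc m" by (simp_all add: n)
    \<comment> \<open>Here \<open>p\<close> is the power of 2 and \<open>q\<close> is
      \<open>5 ^ m\<close>; \<open>u\<close>, \<open>w\<close> are the powers with exponent
      \<open>4 * int n + s\<close>, and \<open>v\<close>, \<open>z\<close> those with
      \<open>2 * int n + s\<close>. The opposite signs turn \<open>v - z\<close> into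
      \<open>v + z\<close> and back. In the second identity \<open>sqrt 5 * (v - z)\<close> is
      \<open>5 * ((v - z) / sqrt 5)\<close>, which raises the power of 5 to
      \<open>Suc m\<close>.\<close>
    have combine:
      "(p * (u + - (q * sqrt 5) * v) - p * (w + q * sqrt 5 * z)) / sqrt 5 = p * ((u - w) / sqrt 5 - q * (v + z))"
      "p * (u + - (q * sqrt 5) * v) + p * (w + q * sqrt 5 * z) = p * (u + w - 5 * q * ((v - z) / sqrt 5))"
      for p q u v w z :: real
      by (simp_all add: field_simps)
    show ?thesis
      unfolding F L S_closed pow unfolding fib_int_Binet lucas_int_Binet if_not_P[OF False] div power_Suc
      by (intro conjI combine)
  qed
qed

end
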